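(* Consider the cluster-specific logistic model $$\operatorname{logit}\{P(Y_{j,k}=1\mid \boldsymbol X_{j,k},b_j)\}=\boldsymbol X_{j,k}^T\boldsymbol\beta+b_j,\qquad k=1,\dots,K_j,\ j=1,\dots,J,$$ with binary outcomes $Y_{j,k}\in\{0,1\}$, covariates $\boldsymbol X_{j,k}\in\mathbb R^P$, parameter $\boldsymbol\beta\in\mathbb R^P$ and cluster-specific effects $b_j\in\mathbb{R}$. Assume: (1) (cluster independence) $(\boldsymbol Y_j,\boldsymbol X_j,b_j)$ and $(\boldsymbol Y_{j'},\boldsymbol X_{j'},b_{j'})$ are independent for any $j\ne j'$, where $\boldsymbol Y_j$ and $\boldsymbol X_j$ collect the outcomes and covariates of cluster $j$; (2) (column rank) all entries of the $\boldsymbol X_{j,k}$ are finite, and the $N\times(P+J)$ matrix with rows $(\boldsymbol X_{j,k}^T,\boldsymbol e_j^T)$, $k=1,\dots,K_j$, $j=1,\dots,J$, has full column rank, where $N=\sum_{j=1}^J K_j$ and $\boldsymbol e_j$ is the $j$-th standard basis vector of $\mathbb R^J$. Let the data $(\boldsymbol X_{j,k},Y_{j,k})$ and the numbers $J$ and $K_1,\dots,K_J$ be fixed. Let $\hat{\boldsymbol\beta}^o$ denote the maximum likelihood estimator (MLE) of $\boldsymbol\beta$ and, for each positive integer $R$, let $\hat{\boldsymbol\beta}^c(R)$ denote the conditional maximum likelihood estimator (CMLE) with number of replications $R$. If the MLE $\hat{\boldsymbol\beta}^o$ and the CMLEs $\hat{\boldsymbol\beta}^c(R)$ exist, then $$\lim_{R\to\infty}\hat{\boldsymbol\beta}^c(R)=\hat{\boldsymbol\beta}^o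 .$$
   Context: MLE: a finite-valued maximizer $(\hat{\boldsymbol\beta}^o,\hat{\boldsymbol b}^o)\in\mathbb R^P\times\mathbb R^J$ of the average log-likelihood $$\overline l^o(\boldsymbol\beta,\boldsymbol b)=\frac1N\sum_{j=1}^J\sum_{k=1}^{K_j}\Big\{Y_{j,k}(\boldsymbol X_{j,k}^T\boldsymbol\beta+b_j)-\log\big[1+\exp(\boldsymbol X_{j,k}^T\boldsymbol\beta+b_j)\big]\Big\},\qquad N=\sum_{j=1}^JK_j;$$ "the MLE exists" means that such a finite-valued maximizer exists, and $\hat{\boldsymbol\beta}^o$ denotes its $\boldsymbol\beta$-component. (This average log-likelihood is unchanged when every data point is replicated $R$ times.) CMLE with $R$ replications: every data point $(\boldsymbol X_{j,k},Y_{j,k})$ is replicated $R$ times within its cluster, and $\hat{\boldsymbol\beta}^c(R)\in\mathbb R^P$ is a (finite-valued) maximizer of the average conditional log-likelihood of the replicated data, where in each cluster one conditions on the sum of the (replicated) outcomes. Explicitly, this function is $$l^c_R(\boldsymbol\beta)=\frac1{RN}\left[R\sum_{j=1}^J\sum_{k=1}^{K_j}Y_{j,k}\boldsymbol X_{j,k}^T\boldsymbol\beta-\sum_{j=1}^J\log g_{j,R,T_j}(\boldsymbol\beta)\right],\qquad T_j=\sum_{k=1}^{K_j}Y_{j,k},$$ $$g_{j,R,T}(\boldsymbol\beta)=\sum_{\substack{r_1,\dots,r_{K_j}\in\{0,1,\dots,R\}\\ \sum_{s=1}^{K_j}r_s=RT}}\binom R{r_1}\cdots\binom R{r_{K_j}}\exp\Big(\sum_{k=1}^{K_j}r_k\boldsymbol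 X_{j,k}^T\boldsymbol\beta\Big).$$ "The CMLEs exist" means that $l^c_R$ has a finite-valued maximizer for each $R$; $\hat{\boldsymbol\beta}^c(R)$ is any such maximizer. *)

theory Defs
  imports "HOL-Probability.Probability"
begin

text \<open>
  Clusters are indexed by a finite type \<open>'j\<close> (so \<open>J = CARD('j)\<close>), the observations of cluster
  \<open>j\<close> by \<open>{1..K j}\<close>, and covariates live in \<open>real ^ 'p\<close> (so \<open>P = CARD('p)\<close>). Values of
  \<open>Y j k\<close> and \<open>X j k\<close> for \<open>k\<close> outside \<open>{1..K j}\<close> are never used.
\<close>

definition logit :: "real \<Rightarrow> real" where
  "logit p = ln (p / (1 - p))"

definition cond_prob_given :: "'w measure \<Rightarrow> 'w set \<Rightarrow> ('w \<Rightarrow> 'z::topological_space) \<Rightarrow> 'w \<Rightarrow> real" where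
  "cond_prob_given M E Z = real_cond_exp M (vimage_algebra (space M) Z borel) (indicator E)"

definition cluster_data ::
  "('j \<Rightarrow> nat) \<Rightarrow> ('j \<Rightarrow> nat \<Rightarrow> 'w \<Rightarrow> nat) \<Rightarrow> ('j \<Rightarrow> nat \<Rightarrow> 'w \<Rightarrow> real ^ 'p::finite) \<Rightarrow>
    ('j \<Rightarrow> 'w \<Rightarrow> real) \<Rightarrow> 'j \<Rightarrow> 'w \<Rightarrow> (nat \<Rightarrow> nat) \<times> (nat \<Rightarrow> real ^ 'p) \<times> real" where
  "cluster_data K Y X b j \<omega> = ((\<lambda>k\<in>{1..K j}. Y j k \<omega>), (\<lambda>k\<in>{1..K j}. X j k \<omega>), b j \<omega>)"

definition cluster_space ::
  "('j \<Rightarrow> nat) \<Rightarrow> 'j \<Rightarrow> ((nat \<Rightarrow> nat) \<times> (nat \<Rightarrow> real ^ 'p::finite) \<times> real) measure" where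
  "cluster_space K j =
     (\<Pi>\<^sub>M k\<in>{1..K j}. count_space UNIV) \<Otimes>\<^sub>M (\<Pi>\<^sub>M k\<in>{1..K j}. borel) \<Otimes>\<^sub>M borel"

text \<open>
  In \<open>logistic\<close> the conditional probability is required to lie strictly between 0 and 1 because
  \<open>logit\<close> takes the junk value 0 at 0 and 1. Independence of the clusters is pairwise.
\<close>

locale cluster_logistic_model = prob_space M
  for M :: "'w measure" +
  fixes K :: "'j::finite \<Rightarrow> nat"
    and Y :: "'j \<Rightarrow> nat \<Rightarrow> 'w \<Rightarrow> nat"
    and X :: "'j \<Rightarrow> nat \<Rightarrow> 'w \<Rightarrow> real ^ 'p::finite"
    and b :: "'j \<Rightarrow> 'w \<Rightarrow> real"
    and \<beta> :: "real ^ 'p"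
  assumes Y_measurable: "k \<in> {1..K j} \<Longrightarrow> Y j k \<in> measurable M (count_space UNIV)"
    and X_measurable: "k \<in> {1..K j} \<Longrightarrow> X j k \<in> borel_measurable M"
    and b_measurable: "b j \<in> borel_measurable M"
    and Y_binary: "k \<in> {1..K j} \<Longrightarrow> \<omega> \<in> space M \<Longrightarrow> Y j k \<omega> \<in> {0, 1}"
    and logistic: "k \<in> {1..K j} \<Longrightarrow>
      AE \<omega> in M.
        let p = cond_prob_given M {\<omega> \<in> space M. Y j k \<omega> = 1} (\<lambda>\<omega>. (X j k \<omega>, b j \<omega>)) \<omega>
        in 0 < p \<and> p < 1 \<and> logit p = X j k \<omega> \<bullet> \<beta> + b j \<omega>"
    and cluster_independence: "j \<noteq> j' \<Longrightarrow>
      indep_var (cluster_space K j) (cluster_data K Y X b j)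
                (cluster_space K j') (cluster_data K Y X b j')"

definition num_obs :: "('j::finite \<Rightarrow> nat) \<Rightarrow> nat" where
  "num_obs K = (\<Sum>j\<in>UNIV. K j)"

definition design_row :: "('j \<Rightarrow> nat \<Rightarrow> real ^ 'p) \<Rightarrow> 'j \<Rightarrow> nat \<Rightarrow> real ^ ('p::finite + 'j::finite)" where
  "design_row x j k = (\<chi> q. case q of Inl p \<Rightarrow> x j k $ p | Inr i \<Rightarrow> axis j 1 $ i)"

definition design_rows ::
  "('j \<Rightarrow> nat) \<Rightarrow> ('j \<Rightarrow> nat \<Rightarrow> real ^ 'p) \<Rightarrow> (real ^ ('p::finite + 'j::finite)) set" where
  "design_rows K x = {design_row x j k | j k. k \<in> {1..K j}}"

text \<open>
  The number \<open>N\<close> of rows depends on \<open>K\<close>, so the design matrix has no type \<open>real ^ _ ^ _\<close>. Its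
  rank is therefore given as what \<^const>\<open>rank\<close> unfolds to, the dimension of the set of rows; the lemma
  below shows that it is the \<^const>\<open>rank\<close> of the matrix obtained by listing the rows along any
  enumeration of the observations.
\<close>

definition design_rank :: "('j::finite \<Rightarrow> nat) \<Rightarrow> ('j \<Rightarrow> nat \<Rightarrow> real ^ 'p::finite) \<Rightarrow> nat" where
  "design_rank K x = dim (design_rows K x)"

lemma rank_eq_design_rank:
  fixes x :: "'j::finite \<Rightarrow> nat \<Rightarrow> real ^ 'p::finite" and obs :: "'n::finite \<Rightarrow> 'j \<times> nat"
  assumes "bij_betw obs UNIV (SIGMA j:UNIV. {1..K j})"
  shows "rank (\<chi> n. case obs n of (j, k) \<Rightarrow> design_row x j k) = design_rank K x"
proof -
  have "rows (\<chi> n. case obs n of (j, k) \<Rightarrow> design_row x j k)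
      = (\<lambda>(j, k). design_row x j k) ` range obs"
    by (simp add: rows_def row_def full_SetCompr_eq image_image case_prod_beta)
  also have "range obs = (SIGMA j:UNIV. {1..K j})"
    using assms by (simp add: bij_betw_def)
  also have "(\<lambda>(j, k). design_row x j k) ` (SIGMA j:UNIV. {1..K j}) = design_rows K x"
    by (force simp: design_rows_def)
  finally show ?thesis
    by (simp add: row_rank_def design_rank_def)
qed

definition full_column_rank :: "('j::finite \<Rightarrow> nat) \<Rightarrow> ('j \<Rightarrow> nat \<Rightarrow> real ^ 'p::finite) \<Rightarrow> bool" where
  "full_column_rank K x \<longleftrightarrow> design_rank K x = CARD('p) + CARD('j)"

definition avg_loglik ::
  "('j::finite \<Rightarrow> nat) \<Rightarrow> ('j \<Rightarrow> nat \<Rightarrow> real ^ 'p::finite) \<Rightarrow> ('j \<Rightarrow> nat \<Rightarrow> nat) \<Rightarrow>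
    real ^ 'p \<Rightarrow> real ^ 'j \<Rightarrow> real" where
  "avg_loglik K x y \<beta> b =
     1 / real (num_obs K) *
     (\<Sum>j\<in>UNIV. \<Sum>k=1..K j.
        real (y j k) * (x j k \<bullet> \<beta> + b $ j) - ln (1 + exp (x j k \<bullet> \<beta> + b $ j)))"

definition is_MLE ::
  "('j::finite \<Rightarrow> nat) \<Rightarrow> ('j \<Rightarrow> nat \<Rightarrow> real ^ 'p::finite) \<Rightarrow> ('j \<Rightarrow> nat \<Rightarrow> nat) \<Rightarrow>
    real ^ 'p \<Rightarrow> bool" where
  "is_MLE K x y \<beta>\<^sub>o \<longleftrightarrow>
     (\<exists>b\<^sub>o. is_arg_max (\<lambda>(\<beta>, b). avg_loglik K x y \<beta> b) (\<lambda>_. True) (\<beta>\<^sub>o, b\<^sub>o))"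

definition cond_normalizer ::
  "('j \<Rightarrow> nat) \<Rightarrow> ('j \<Rightarrow> nat \<Rightarrow> real ^ 'p::finite) \<Rightarrow> 'j \<Rightarrow> nat \<Rightarrow> nat \<Rightarrow> real ^ 'p \<Rightarrow> real" where
  "cond_normalizer K x j R T \<beta> =
     (\<Sum>r \<in> {r \<in> {1..K j} \<rightarrow>\<^sub>E {0..R}. (\<Sum>s=1..K j. r s) = R * T}.
        (\<Prod>k=1..K j. real (R choose r k)) * exp (\<Sum>k=1..K j. real (r k) * (x j k \<bullet> \<beta>)))"

definition avg_cond_loglik ::
  "('j::finite \<Rightarrow> nat) \<Rightarrow> ('j \<Rightarrow> nat \<Rightarrow> real ^ 'p::finite) \<Rightarrow> ('j \<Rightarrow> nat \<Rightarrow> nat) \<Rightarrow>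
    nat \<Rightarrow> real ^ 'p \<Rightarrow> real" where
  "avg_cond_loglik K x y R \<beta> =
     1 / (real R * real (num_obs K)) *
     (real R * (\<Sum>j\<in>UNIV. \<Sum>k=1..K j. real (y j k) * (x j k \<bullet> \<beta>))
      - (\<Sum>j\<in>UNIV. ln (cond_normalizer K x j R (\<Sum>k=1..K j. y j k) \<beta>)))"

definition is_CMLE ::
  "('j::finite \<Rightarrow> nat) \<Rightarrow> ('j \<Rightarrow> nat \<Rightarrow> real ^ 'p::finite) \<Rightarrow> ('j \<Rightarrow> nat \<Rightarrow> nat) \<Rightarrow>
    nat \<Rightarrow> real ^ 'p \<Rightarrow> bool" where
  "is_CMLE K x y R \<beta>\<^sub>c \<longleftrightarrow> is_arg_max (avg_cond_loglik K x y R) (\<lambda>_. True) \<beta>\<^sub>c"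

end

theory Submission
  imports Defs "HOL-Computational_Algebra.Polynomial" "HOL-Real_Asymp.Real_Asymp"
begin

text \<open>
  For cluster \<open>j\<close> the normalizer of the conditional likelihood is a coefficient: it is the
  coefficient of \<open>z ^ (R * T\<^sub>j)\<close> in \<open>\<Prod>\<^sub>k (1 + exp (x\<^sub>j\<^sub>k \<bullet> \<beta>) z) ^ R\<close>. Multiplying it by
  \<open>exp (b R T\<^sub>j)\<close> gives the coefficient of the same power after the substitution
  \<open>z \<mapsto> exp b * z\<close>, and the value of the new polynomial at 1 is
  \<open>\<Prod>\<^sub>k (1 + exp (x\<^sub>j\<^sub>k \<bullet> \<beta> + b)) ^ R\<close>, the normalizer of the full likelihood to the power \<open>R\<close>.
  So both likelihoods are compared by comparing one coefficient with the sum of all of them.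

  \<^item> A coefficient is at most the sum. This holds for every \<open>b\<close>, so the conditional
    log-likelihood at \<open>\<beta>\<close> is at least the full log-likelihood at \<open>(\<beta>, b)\<close>
    (\<open>avg_loglik_le_avg_cond_loglik\<close>).
  \<^item> Normalized to sum 1, the coefficients are the distribution of a sum of independent Bernoulli
    variables. It is log-concave, hence unimodal, and the weight that a unimodal distribution on
    \<open>{0..n}\<close> gives to its mean, if that is an integer, is at least \<open>1 / (n + 1)\<^sup>2\<close>
    (\<open>poly_one_le_coeff_at_mean\<close>). The mean is \<open>R * T\<^sub>j\<close> exactly when \<open>b\<close> solves the score
    equation of cluster \<open>j\<close>. For this \<open>b = b(\<beta>)\<close> the first bound is sharp up to a polynomial
    factor, which after taking logarithms and dividing by \<open>R\<close> costs \<open>O(ln R / R)\<close>, uniformly in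
    \<open>\<beta>\<close> (\<open>avg_cond_loglik_le_avg_loglik\<close>).

  Existence of the MLE makes the score equations solvable: they hold at the MLE, and moving from
  there to another \<open>\<beta>\<close> can be compensated by a shift of \<open>b\<close>, by the intermediate value theorem.

  Chaining the two bounds through the optimality of \<open>\<beta>\<^sub>c R\<close> shows that the points
  \<open>(\<beta>\<^sub>c R, b(\<beta>\<^sub>c R))\<close> form a maximizing sequence of the full log-likelihood. That function is concave
  and, by the rank condition, has only one maximizer; maximizing sequences of such a function
  converge (\<open>concave_maximizing_sequence_tendsto\<close>).
\<close>

section \<open>Positive log-concave coefficient sequences\<close>

text \<open>
  The inequality is the one for non-adjacent indices \<open>i \<le> j\<close>, rather than
  \<open>c\<^sub>i * c\<^sub>i\<^sub>+\<^sub>2 \<le> c\<^sub>i\<^sub>+\<^sub>1\<^sup>2\<close>: it says that the ratio of consecutive coefficients decreases, and in this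
  form it passes directly through multiplication by a linear factor.
\<close>

definition pos_log_concave :: "real poly \<Rightarrow> bool" where
  "pos_log_concave p \<longleftrightarrow>
     (\<forall>i \<le> degree p. 0 < coeff p i) \<and>
     (\<forall>i j. i \<le> j \<longrightarrow> coeff p i * coeff p (Suc j) \<le> coeff p (Suc i) * coeff p j)"

lemma pos_log_concave_nonneg:
  assumes "pos_log_concave p"
  shows "0 \<le> coeff p i"
  using assms by (cases "i \<le> degree p") (auto simp: pos_log_concave_def coeff_eq_0 intro: less_imp_le)

lemma pos_log_concave_one: "pos_log_concave 1"
  by (auto simp: pos_log_concave_def coeff_1)

text \<open>
  Expanded in powers of \<open>a\<close>, the inequality to be shown splits into three: the given one at
  \<open>(i, j)\<close>, the given one at \<open>(i - 1, j - 1)\<close>, and a mixed one, which follows by applying the given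
  one twice, or is an equality if \<open>i = j\<close>.
\<close>

lemma pos_log_concave_mult_linear:
  assumes p: "pos_log_concave p" and a: "0 < a"
  shows "pos_log_concave ([:1, a:] * p)"
proof -
  let ?c = "coeff p"
  have nn: "0 \<le> ?c i" for i
    using p by (rule pos_log_concave_nonneg)
  have lc: "?c i * ?c (Suc j) \<le> ?c (Suc i) * ?c j" if "i \<le> j" for i j
    using p that by (auto simp: pos_log_concave_def)
  have q: "[:1, a:] * p = p + pCons 0 (smult a p)"
    by simp
  have c0: "coeff ([:1, a:] * p) 0 = ?c 0"
    unfolding q by simp
  have cS: "coeff ([:1, a:] * p) (Suc i) = ?c (Suc i) + a * ?c i" for i
    unfolding q by simp
  have "p \<noteq> 0"
    using p by (auto simp: pos_log_concave_def)
  then have deg: "degree ([:1, a:] * p) = Suc (degree p)"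
    using a by (subst degree_mult_eq) auto
  have pos: "0 < coeff ([:1, a:] * p) i" if "i \<le> Suc (degree p)" for i
  proof (cases i)
    case 0
    then show ?thesis
      using p c0 by (auto simp: pos_log_concave_def)
  next
    case (Suc i')
    then have "0 < ?c i'"
      using p that by (auto simp: pos_log_concave_def)
    then show ?thesis
      using Suc cS[of i'] a nn[of "Suc i'"] by (simp add: add_nonneg_pos)
  qed
  have "coeff ([:1, a:] * p) i * coeff ([:1, a:] * p) (Suc j)
      \<le> coeff ([:1, a:] * p) (Suc i) * coeff ([:1, a:] * p) j" if "i \<le> j" for i j
  proof (cases i)
    case 0
    show ?thesis
    proof (cases j)
      case 0
      with \<open>i = 0\<close> show ?thesis
        by (simp only: mult.commute)
    next
      case (Suc j')
      have "0 \<le> ?c (Suc 0) * (a * ?c j')" "0 \<le> a * ?c 0 * (a * ?c j')"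
        using nn a by simp_all
      then show ?thesis
        using lc[of 0 j] \<open>i = 0\<close> Suc by (simp only: c0 cS) (simp add: algebra_simps)
    qed
  next
    case (Suc i')
    then obtain j' where j': "j = Suc j'" and le: "i' \<le> j'"
      using \<open>i \<le> j\<close> by (cases j) auto
    have 1: "?c (Suc i') * ?c (Suc (Suc j')) \<le> ?c (Suc (Suc i')) * ?c (Suc j')"
      using lc[of "Suc i'" "Suc j'"] le by simp
    have 2: "?c i' * ?c (Suc j') \<le> ?c (Suc i') * ?c j'"
      using lc le by blast
    have 3: "?c i' * ?c (Suc (Suc j')) \<le> ?c (Suc (Suc i')) * ?c j'"
    proof (cases "i' = j'")
      case True
      then show ?thesis by simp
    next
      case False
      have "?c i' * ?c (Suc (Suc j')) \<le> ?c (Suc i') * ?c (Suc j')"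
        using lc[of i' "Suc j'"] le by simp
      also have "\<dots> \<le> ?c (Suc (Suc i')) * ?c j'"
        using lc[of "Suc i'" j'] le False by simp
      finally show ?thesis .
    qed
    have "a * (?c i' * ?c (Suc (Suc j'))) \<le> a * (?c (Suc (Suc i')) * ?c j')"
      using 3 a by simp
    moreover have "a * a * (?c i' * ?c (Suc j')) \<le> a * a * (?c (Suc i') * ?c j')"
      using 2 a by simp
    ultimately show ?thesis
      unfolding Suc j' cS using 1 by (simp add: algebra_simps)
  qed
  then show ?thesis
    unfolding pos_log_concave_def deg using pos by blast
qed

lemma pos_log_concave_mult_linear_power:
  assumes "pos_log_concave p" "0 < a"
  shows "pos_log_concave ([:1, a:] ^ R * p)"
proof (induction R)
  case (Suc R)
  then show ?case
    using pos_log_concave_mult_linear[OF Suc.IH \<open>0 < a\<close>] by (simp only: power_Suc mult.assoc)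
qed (use assms in simp)

lemma poly_pderiv_one:
  fixes p :: "real poly"
  shows "poly (pderiv p) 1 = (\<Sum>i\<le>degree p. real i * coeff p i)"
proof -
  have "(poly p has_real_derivative poly (pderiv p) 1) (at 1)"
    by (rule poly_DERIV)
  moreover have "((\<lambda>z. \<Sum>i\<le>degree p. coeff p i * z ^ i) has_real_derivative
      (\<Sum>i\<le>degree p. real i * coeff p i)) (at 1)"
    by (auto intro!: derivative_eq_intros sum.cong)
  ultimately show ?thesis
    by (simp add: DERIV_unique poly_altdef[abs_def])
qed

text \<open>
  The coefficients of \<open>p\<close> are regarded as weights on \<open>{0..degree p}\<close>; the hypothesis \<open>mean\<close> says that
  their mean is \<open>m\<close>. Log-concavity makes the weights monotone on at least one side of \<open>m\<close>, towards
  \<open>m\<close>. On that side every weight is at most the weight of \<open>m\<close>, and because the first moments of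
  both sides about \<open>m\<close> agree, this side controls the other one as well.
\<close>

lemma poly_one_le_coeff_at_mean:
  assumes p: "pos_log_concave p" and m: "m \<le> degree p"
    and mean: "poly (pderiv p) 1 = real m * poly p 1"
  shows "poly p 1 \<le> (real (degree p) + 1)\<^sup>2 * coeff p m"
proof -
  let ?c = "coeff p" and ?n = "degree p"
  have nn: "0 \<le> ?c i" for i
    using p by (rule pos_log_concave_nonneg)
  have cm: "0 < ?c m"
    using p m by (auto simp: pos_log_concave_def)
  have total: "poly p 1 = (\<Sum>i\<le>?n. ?c i)"
    by (simp add: poly_altdef)
  have centred: "(\<Sum>i\<le>?n. ?c i * (real i - real m)) = 0"
    using mean unfolding poly_pderiv_one total
    by (simp add: algebra_simps sum_subtractf sum_distrib_left)
  (* With s = -1 or s = 1 the added multiple of the centred moment makes the terms on the side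
     without monotonicity nonpositive, since i and m are integers. *)
  obtain s :: real where s: "\<And>i. i \<le> ?n \<Longrightarrow> ?c i * (1 + s * (real i - real m)) \<le> (real ?n + 1) * ?c m"
  proof (cases "?c m \<le> ?c (Suc m)")
    case True
    have step: "?c i \<le> ?c (Suc i)" if "i \<le> m" for i
    proof -
      have "?c i * ?c m \<le> ?c i * ?c (Suc m)"
        using True nn by (simp add: mult_left_mono)
      also have "\<dots> \<le> ?c (Suc i) * ?c m"
        using p that by (auto simp: pos_log_concave_def)
      finally show ?thesis
        using cm by simp
    qed
    have up: "?c i \<le> ?c m" if "i \<le> m" for i
      using that by (induction i rule: inc_induct) (auto intro: order_trans[OF step])
    have "?c i * (1 + (- 1) * (real i - real m)) \<le> (real ?n + 1) * ?c m" for i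
    proof (cases "i \<le> m")
      case True
      then have "(1 + (real m - real i)) * ?c i \<le> (real ?n + 1) * ?c m"
        using m up nn by (intro mult_mono) auto
      then show ?thesis by (simp add: algebra_simps)
    next
      case False
      then have "?c i * (1 + (- 1) * (real i - real m)) \<le> 0"
        using nn by (intro mult_nonneg_nonpos) auto
      also have "0 \<le> (real ?n + 1) * ?c m"
        using cm by simp
      finally show ?thesis .
    qed
    then show ?thesis using that by blast
  next
    case False
    have step: "?c (Suc j) \<le> ?c j" if "m \<le> j" for j
    proof -
      have "?c m * ?c (Suc j) \<le> ?c (Suc m) * ?c j"
        using p that by (auto simp: pos_log_concave_def)
      also have "\<dots> \<le> ?c m * ?c j"
        using False nn by (simp add: mult_right_mono)
      finally show ?thesis
        using cm by simp
    qed
    have down: "?c i \<le> ?c m" if "m \<le> i" for i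
      using that by (induction i rule: dec_induct) (auto intro: order_trans[OF step])
    have "?c i * (1 + 1 * (real i - real m)) \<le> (real ?n + 1) * ?c m" if "i \<le> ?n" for i
    proof (cases "m \<le> i")
      case True
      then have "(1 + (real i - real m)) * ?c i \<le> (real ?n + 1) * ?c m"
        using \<open>i \<le> ?n\<close> down nn by (intro mult_mono) auto
      then show ?thesis by (simp add: algebra_simps)
    next
      case False
      then have "?c i * (1 + 1 * (real i - real m)) \<le> 0"
        using nn by (intro mult_nonneg_nonpos) auto
      also have "0 \<le> (real ?n + 1) * ?c m"
        using cm by simp
      finally show ?thesis .
    qed
    then show ?thesis using that by blast
  qed
  have "poly p 1 = (\<Sum>i\<le>?n. ?c i) + s * (\<Sum>i\<le>?n. ?c i * (real i - real m))"
    by (simp add: centred total)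
  also have "\<dots> = (\<Sum>i\<le>?n. ?c i * (1 + s * (real i - real m)))"
    by (simp add: algebra_simps sum.distrib sum_subtractf sum_distrib_left)
  also have "\<dots> \<le> (\<Sum>i\<le>?n. (real ?n + 1) * ?c m)"
    by (intro sum_mono s) simp
  finally show ?thesis
    by (simp add: power2_eq_square mult.assoc add.commute)
qed

section \<open>The conditional normalizer as a coefficient\<close>

definition binomial_gf :: "'k set \<Rightarrow> nat \<Rightarrow> ('k \<Rightarrow> real) \<Rightarrow> real poly" where
  "binomial_gf A R u = (\<Prod>k\<in>A. [:1, exp (u k):] ^ R)"

lemma binomial_gf_one: "poly (binomial_gf A R u) 1 = (\<Prod>k\<in>A. (1 + exp (u k)) ^ R)"
  by (simp add: binomial_gf_def poly_prod)

lemma linear_power_eq_sum_monom: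
  fixes a :: real
  shows "[:1, a:] ^ R = (\<Sum>r\<in>{0..R}. monom (real (R choose r) * a ^ r) r)"
proof -
  have "[:1, a:] = monom a 1 + 1"
    by (simp add: monom_altdef one_pCons)
  then show ?thesis
    by (simp add: binomial_ring atLeast0AtMost monom_power of_nat_monom mult_monom)
qed

lemma coeff_binomial_gf:
  assumes A: "finite A"
  shows "coeff (binomial_gf A R u) m =
    (\<Sum>r \<in> {r \<in> A \<rightarrow>\<^sub>E {0..R}. sum r A = m}.
       (\<Prod>k\<in>A. real (R choose r k)) * exp (\<Sum>k\<in>A. real (r k) * u k))"
proof -
  have monom_prod: "(\<Prod>k\<in>A. monom (f k) (r k)) = monom (\<Prod>k\<in>A. f k) (sum r A)"
    for f :: "'a \<Rightarrow> real" and r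
    using A by (induction A rule: finite_induct) (auto simp: mult_monom)
  have fin: "finite (A \<rightarrow>\<^sub>E {0..R})"
    using A by (intro finite_PiE) auto
  have "binomial_gf A R u
      = (\<Sum>r\<in>A \<rightarrow>\<^sub>E {0..R}. monom (\<Prod>k\<in>A. real (R choose r k) * exp (u k) ^ r k) (sum r A))"
    unfolding binomial_gf_def linear_power_eq_sum_monom
    using A by (subst prod_sum_PiE) (auto simp: monom_prod)
  then have "coeff (binomial_gf A R u) m
      = (\<Sum>r\<in>A \<rightarrow>\<^sub>E {0..R}. if sum r A = m
           then \<Prod>k\<in>A. real (R choose r k) * exp (u k) ^ r k else 0)"
    by (simp add: coeff_sum)
  also have "\<dots> = (\<Sum>r \<in> {r \<in> A \<rightarrow>\<^sub>E {0..R}. sum r A = m}.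
      \<Prod>k\<in>A. real (R choose r k) * exp (u k) ^ r k)"
    using fin by (simp add: sum.inter_filter)
  finally show ?thesis
    using A by (simp add: prod.distrib exp_sum exp_of_nat_mult)
qed

lemma cond_normalizer_eq_coeff:
  "cond_normalizer K x j R T \<beta> = coeff (binomial_gf {1..K j} R (\<lambda>k. x j k \<bullet> \<beta>)) (R * T)"
  by (simp add: cond_normalizer_def coeff_binomial_gf)

text \<open>
  Adding \<open>b\<close> to every \<open>u k\<close> rescales the variable of the generating function, that is, tilts the
  weights exponentially.
\<close>

lemma coeff_binomial_gf_shift:
  assumes "finite A"
  shows "coeff (binomial_gf A R (\<lambda>k. u k + b)) m = exp (b * real m) * coeff (binomial_gf A R u) m"
proof -
  have "exp (\<Sum>k\<in>A. real (r k) * (u k + b))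
      = exp (b * real m) * exp (\<Sum>k\<in>A. real (r k) * u k)" if "sum r A = m" for r
  proof -
    have "(\<Sum>k\<in>A. real (r k) * b) = b * real m"
      using that by (simp add: mult.commute flip: sum_distrib_left of_nat_sum)
    then show ?thesis
      by (simp add: distrib_left sum.distrib exp_add)
  qed
  then show ?thesis
    unfolding coeff_binomial_gf[OF assms] sum_distrib_left
    by (intro sum.cong) auto
qed

lemma pos_log_concave_binomial_gf:
  assumes "finite A"
  shows "pos_log_concave (binomial_gf A R u)"
  using assms unfolding binomial_gf_def
  by (induction A rule: finite_induct)
    (auto simp: pos_log_concave_one intro!: pos_log_concave_mult_linear_power)

lemma degree_binomial_gf:
  assumes "finite A"
  shows "degree (binomial_gf A R u) = R * card A"
  using assms unfolding binomial_gf_def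
  by (subst degree_prod_eq_sum_degree) (auto simp: degree_power_eq)

text \<open>
  The mean of the coefficient weights: each of the \<open>R\<close> copies of \<open>k\<close> is a Bernoulli variable with
  success probability \<open>exp (u k) / (1 + exp (u k))\<close>.
\<close>

lemma pderiv_binomial_gf_one:
  assumes "finite A"
  shows "poly (pderiv (binomial_gf A R u)) 1 =
    real R * (\<Sum>k\<in>A. exp (u k) / (1 + exp (u k))) * poly (binomial_gf A R u) 1"
  using assms
proof (induction A rule: finite_induct)
  case empty
  then show ?case by (simp add: binomial_gf_def)
next
  case (insert k A)
  have ins: "binomial_gf (insert k A) R u = [:1, exp (u k):] ^ R * binomial_gf A R u"
    using insert by (simp add: binomial_gf_def)
  have "1 + exp (u k) \<noteq> 0"
    using exp_gt_zero[of "u k"] by linarith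
  then have one: "poly (pderiv ([:1, exp (u k):] ^ R)) 1
      = real R * (exp (u k) / (1 + exp (u k))) * (1 + exp (u k)) ^ R"
  proof (cases R)
    case (Suc R')
    have "poly (pderiv ([:1, exp (u k):] ^ R)) 1 = real R * (1 + exp (u k)) ^ R' * exp (u k)"
      unfolding Suc pderiv_power_Suc by (simp add: pderiv_pCons del: of_nat_Suc)
    then show ?thesis
      using \<open>1 + exp (u k) \<noteq> 0\<close> Suc by simp
  qed (simp add: pderiv_1)
  show ?case
    unfolding ins pderiv_mult poly_add poly_mult insert.IH one
    using insert by (simp add: algebra_simps)
qed

lemma coeff_binomial_gf_upper:
  assumes "finite A"
  shows "exp (b * real m) * coeff (binomial_gf A R u) m \<le> (\<Prod>k\<in>A. (1 + exp (u k + b)) ^ R)"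
proof -
  let ?p = "binomial_gf A R (\<lambda>k. u k + b)"
  have nn: "0 \<le> coeff ?p i" for i
    by (intro pos_log_concave_nonneg pos_log_concave_binomial_gf assms)
  have "coeff ?p m \<le> (\<Sum>i\<le>degree ?p. coeff ?p i)"
  proof (cases "m \<le> degree ?p")
    case True
    then show ?thesis
      using nn by (intro member_le_sum) auto
  next
    case False
    then show ?thesis
      using nn by (simp add: coeff_eq_0 sum_nonneg)
  qed
  also have "\<dots> = poly ?p 1"
    by (simp add: poly_altdef)
  finally show ?thesis
    by (simp add: coeff_binomial_gf_shift assms binomial_gf_one)
qed

lemma logistic_less_one:
  fixes z :: real
  shows "exp z / (1 + exp z) < 1"
  by (simp add: add_pos_pos pos_divide_less_eq)

text \<open>
  The tilt \<open>b\<close> is chosen so that the mean of the tilted weights is the index \<open>R * T\<close> itself. The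
  same condition forces \<open>T \<le> card A\<close>, so that the coefficient is positive.
\<close>

lemma coeff_binomial_gf_lower:
  assumes A: "finite A"
    and mean: "(\<Sum>k\<in>A. exp (u k + b) / (1 + exp (u k + b))) = real T"
  shows "(\<Prod>k\<in>A. (1 + exp (u k + b)) ^ R)
    \<le> (real (R * card A) + 1)\<^sup>2 * (exp (b * real (R * T)) * coeff (binomial_gf A R u) (R * T))"
    and "0 < coeff (binomial_gf A R u) (R * T)"
proof -
  let ?p = "binomial_gf A R (\<lambda>k. u k + b)"
  have "real T \<le> (\<Sum>k\<in>A. 1)"
    unfolding mean[symmetric] by (intro sum_mono less_imp_le logistic_less_one)
  then have T: "R * T \<le> R * card A"
    by simp
  have lc: "pos_log_concave ?p"
    by (rule pos_log_concave_binomial_gf[OF A])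
  show "0 < coeff (binomial_gf A R u) (R * T)"
    using pos_log_concave_binomial_gf[OF A, of R u] T
    by (auto simp: pos_log_concave_def degree_binomial_gf A)
  have "poly ?p 1 \<le> (real (degree ?p) + 1)\<^sup>2 * coeff ?p (R * T)"
    using lc by (rule poly_one_le_coeff_at_mean)
      (use T in \<open>simp_all add: degree_binomial_gf pderiv_binomial_gf_one A mean\<close>)
  then show "(\<Prod>k\<in>A. (1 + exp (u k + b)) ^ R)
    \<le> (real (R * card A) + 1)\<^sup>2 * (exp (b * real (R * T)) * coeff (binomial_gf A R u) (R * T))"
    by (simp only: binomial_gf_one degree_binomial_gf[OF A] coeff_binomial_gf_shift[OF A])
qed

lemma ln_prod_logistic_power:
  fixes u :: "'k \<Rightarrow> real"
  assumes "finite A"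
  shows "ln (\<Prod>k\<in>A. (1 + exp (u k)) ^ R) = real R * (\<Sum>k\<in>A. ln (1 + exp (u k)))"
proof -
  have "1 + exp (u k) \<noteq> 0" for k
    using exp_gt_zero[of "u k"] by linarith
  then show ?thesis
    by (subst ln_prod) (auto simp: assms add_pos_pos ln_realpow sum_distrib_left)
qed

section \<open>Maximizing sequences of concave functions\<close>

text \<open>
  On a sphere around the maximizer \<open>a\<close> the values stay below \<open>f a\<close> by a fixed gap. A point
  outside the sphere with a value inside this gap is impossible: where the segment to \<open>a\<close> crosses
  the sphere, concavity would make the value too large.
\<close>

lemma concave_maximizing_sequence_tendsto:
  fixes f :: "'a::euclidean_space \<Rightarrow> real"
  assumes concave: "concave_on UNIV f"
    and max: "\<And>v. f v \<le> f a"
    and unique: "\<And>v. f v = f a \<Longrightarrow> v = a"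
    and maximizing: "(\<lambda>n. f (\<theta> n)) \<longlonglongrightarrow> f a"
  shows "\<theta> \<longlonglongrightarrow> a"
proof (rule tendstoI)
  fix \<epsilon> :: real
  assume \<epsilon>: "0 < \<epsilon>"
  have "continuous_on UNIV (\<lambda>v. - f v)"
    using concave by (intro convex_on_continuous) (auto simp: concave_on_def)
  then have "continuous_on UNIV f"
    using continuous_on_minus by force
  then have "continuous_on (sphere a \<epsilon>) f"
    by (rule continuous_on_subset) simp
  then obtain s where s: "s \<in> sphere a \<epsilon>" and s_max: "\<And>v. v \<in> sphere a \<epsilon> \<Longrightarrow> f v \<le> f s"
    using continuous_attains_sup[of "sphere a \<epsilon>" f] \<epsilon> by auto
  have "s \<noteq> a"
    using s \<epsilon> by auto
  then have "f s < f a"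
    using max[of s] unique[of s] by force
  then have "\<forall>\<^sub>F n in sequentially. f s < f (\<theta> n)"
    using maximizing by (rule order_tendstoD(1)[rotated])
  then show "\<forall>\<^sub>F n in sequentially. dist (\<theta> n) a < \<epsilon>"
  proof eventually_elim
    case (elim n)
    show ?case
    proof (rule ccontr)
      assume "\<not> dist (\<theta> n) a < \<epsilon>"
      then have far: "\<epsilon> \<le> norm (\<theta> n - a)"
        by (simp add: dist_norm)
      define t where "t = \<epsilon> / norm (\<theta> n - a)"
      define w where "w = (1 - t) *\<^sub>R a + t *\<^sub>R \<theta> n"
      have t: "0 \<le> t" "t \<le> 1"
        using \<epsilon> far by (auto simp: t_def divide_le_eq)
      have "w - a = t *\<^sub>R (\<theta> n - a)"
        by (simp add: w_def algebra_simps)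
      then have "norm (w - a) = \<epsilon>"
        using \<epsilon> far by (auto simp: t_def)
      then have "w \<in> sphere a \<epsilon>"
        by (simp add: dist_norm norm_minus_commute)
      then have "f w \<le> f s"
        by (rule s_max)
      moreover have "(1 - t) * f a + t * f (\<theta> n) \<le> f w"
        using concave t by (auto simp: concave_on_iff w_def)
      moreover have "(1 - t) * f (\<theta> n) \<le> (1 - t) * f a"
        using t max by (intro mult_left_mono) auto
      ultimately show False
        using elim by (simp add: algebra_simps)
    qed
  qed
qed

section \<open>Strict concavity of the log-likelihood\<close>

text \<open>
  With \<open>a = exp (s / 2)\<close> and \<open>c = exp (t / 2)\<close> this is \<open>(1 + a c)\<^sup>2 < (1 + a\<^sup>2) (1 + c\<^sup>2)\<close>, which is
  \<open>0 < (a - c)\<^sup>2\<close>.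
\<close>

lemma softplus_midpoint_less:
  fixes s t :: real
  assumes "s \<noteq> t"
  shows "2 * ln (1 + exp ((s + t) / 2)) < ln (1 + exp s) + ln (1 + exp t)"
proof -
  let ?a = "exp (s / 2)" and ?c = "exp (t / 2)"
  have "?a \<noteq> ?c"
    using assms by simp
  then have "0 < (?a - ?c)\<^sup>2"
    by simp
  moreover have sq: "exp s = ?a\<^sup>2" "exp t = ?c\<^sup>2" "exp ((s + t) / 2) = ?a * ?c"
    by (simp_all add: power2_eq_square add_divide_distrib flip: exp_add)
  ultimately have "(1 + exp ((s + t) / 2))\<^sup>2 < (1 + exp s) * (1 + exp t)"
    unfolding sq by (simp add: power2_eq_square algebra_simps)
  moreover have pos: "0 < 1 + exp z" for z :: real
    by (simp add: add_pos_pos)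
  ultimately have "ln ((1 + exp ((s + t) / 2))\<^sup>2) < ln ((1 + exp s) * (1 + exp t))"
    by (simp only: ln_less_cancel_iff zero_less_power mult_pos_pos)
  then show ?thesis
    by (simp only: ln_realpow ln_mult_pos of_nat_numeral pos)
qed

lemma convex_on_softplus: "convex_on UNIV (\<lambda>z::real. ln (1 + exp z))"
proof (rule f''_ge0_imp_convex)
  fix z :: real
  have pos: "0 < 1 + exp z"
    by (simp add: add_pos_pos)
  show "((\<lambda>z. ln (1 + exp z)) has_real_derivative exp z / (1 + exp z)) (at z)"
    using pos by (auto intro!: derivative_eq_intros)
  show "((\<lambda>z. exp z / (1 + exp z)) has_real_derivative exp z / (1 + exp z)\<^sup>2) (at z)"
    using pos by (auto intro!: derivative_eq_intros simp: power2_eq_square algebra_simps divide_simps)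
  show "0 \<le> exp z / (1 + exp z)\<^sup>2"
    by simp
qed simp

lemma concave_on_logistic_term:
  fixes u :: "'a::real_vector \<Rightarrow> real"
  assumes "linear u"
  shows "concave_on UNIV (\<lambda>v. c * u v - ln (1 + exp (u v)))"
proof -
  interpret linear u by fact
  show ?thesis
    unfolding concave_on_iff
  proof (intro conjI ballI allI impI)
    fix v w :: 'a and s t :: real
    assume st: "0 \<le> s" "0 \<le> t" "s + t = 1"
    then have "ln (1 + exp (s * u v + t * u w)) \<le> s * ln (1 + exp (u v)) + t * ln (1 + exp (u w))"
      using convex_on_softplus by (auto simp: convex_on_def)
    then show "s * (c * u v - ln (1 + exp (u v))) + t * (c * u w - ln (1 + exp (u w)))
        \<le> c * u (s *\<^sub>R v + t *\<^sub>R w) - ln (1 + exp (u (s *\<^sub>R v + t *\<^sub>R w)))"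
      by (simp add: add scale algebra_simps)
  qed simp
qed

definition linear_predictor ::
  "('j \<Rightarrow> nat \<Rightarrow> real ^ 'p::finite) \<Rightarrow> 'j \<Rightarrow> nat \<Rightarrow> (real ^ 'p) \<times> (real ^ 'j::finite) \<Rightarrow> real" where
  "linear_predictor x j k v = x j k \<bullet> fst v + snd v $ j"

lemma linear_linear_predictor: "linear (linear_predictor x j k)"
  by (rule linearI) (simp_all add: linear_predictor_def inner_add_right algebra_simps)

lemma linear_predictor_eq_inner_design_row:
  "linear_predictor x j k v = design_row x j k \<bullet> (\<chi> q. case q of Inl p \<Rightarrow> fst v $ p | Inr i \<Rightarrow> snd v $ i)"
proof -
  have "(\<Sum>i\<in>UNIV. axis j 1 $ i * snd v $ i) = snd v $ j"
    by (simp add: axis_def if_distrib[of "\<lambda>z. z * _"] sum.delta' cong: if_cong)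
  then show ?thesis
    by (simp add: linear_predictor_def design_row_def inner_vec_def sum.Plus flip: UNIV_Plus_UNIV)
qed

text \<open>
  Full column rank means that the rows span the whole space. Vanishing linear predictors put the
  parameter vector in the orthogonal complement of that span.
\<close>

lemma full_column_rank_linear_predictor:
  fixes x :: "'j::finite \<Rightarrow> nat \<Rightarrow> real ^ 'p::finite" and v :: "(real ^ 'p) \<times> (real ^ 'j)"
  assumes rank: "full_column_rank K x"
    and zero: "\<And>j k. k \<in> {1..K j} \<Longrightarrow> linear_predictor x j k v = 0"
  shows "v = 0"
proof -
  define w :: "real ^ ('p + 'j)" where
    "w = (\<chi> q. case q of Inl p \<Rightarrow> fst v $ p | Inr i \<Rightarrow> snd v $ i)"
  have "span (design_rows K x) = UNIV"
    using rank unfolding full_column_rank_def design_rank_def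
    by (subst dim_eq_full[symmetric]) simp
  moreover have "orthogonal w z" if "z \<in> span (design_rows K x)" for z
  proof (rule orthogonal_to_span[OF that])
    show "orthogonal w z" if "z \<in> design_rows K x" for z
      using that zero
      by (auto simp: design_rows_def orthogonal_def w_def inner_commute
          simp flip: linear_predictor_eq_inner_design_row)
  qed
  ultimately have "w = 0"
    using orthogonal_self by blast
  then have "fst v $ p = 0" "snd v $ i = 0" for p i
    using vec_eq_iff[of w 0]
    by (metis w_def sum.case(1) vec_lambda_beta zero_index,
        metis w_def sum.case(2) vec_lambda_beta zero_index)
  then show ?thesis
    by (simp add: prod_eq_iff vec_eq_iff)
qed

lemma num_obs_pos:
  fixes x :: "'j::finite \<Rightarrow> nat \<Rightarrow> real ^ 'p::finite"
  assumes rank: "full_column_rank K x"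
  shows "0 < num_obs K"
proof (rule ccontr)
  assume "\<not> 0 < num_obs K"
  then have "K j = 0" for j
    by (simp add: num_obs_def)
  (* Without observations every parameter has vanishing linear predictors; a cluster effect serves
     as a nonzero one. *)
  then have "(0, axis undefined 1) = (0 :: (real ^ 'p) \<times> (real ^ 'j))"
    by (intro full_column_rank_linear_predictor[OF rank]) auto
  then show False
    by (simp add: prod_eq_iff axis_eq_0_iff)
qed

lemma avg_loglik_eq_linear_predictor:
  "(case v of (\<beta>, b) \<Rightarrow> avg_loglik K x y \<beta> b) =
     1 / real (num_obs K) * (\<Sum>j\<in>UNIV. \<Sum>k=1..K j.
       real (y j k) * linear_predictor x j k v - ln (1 + exp (linear_predictor x j k v)))"
  by (simp add: avg_loglik_def linear_predictor_def split: prod.split)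

lemma concave_on_UNIV_sum:
  assumes "\<And>i. concave_on UNIV (f i)"
  shows "concave_on UNIV (\<lambda>v. \<Sum>i\<in>S. f i v)"
  by (induction S rule: infinite_finite_induct)
    (auto simp: concave_on_const intro!: concave_on_add assms)

lemma concave_on_avg_loglik:
  "concave_on UNIV (\<lambda>(\<beta>, b). avg_loglik K x y \<beta> b)"
  unfolding avg_loglik_eq_linear_predictor
  by (intro concave_on_cmul concave_on_UNIV_sum concave_on_logistic_term linear_linear_predictor) auto

text \<open>
  Two maximizers differ in some linear predictor by the rank condition, and there the strict
  convexity of \<open>ln (1 + exp z)\<close> would make their midpoint better than both.
\<close>

lemma avg_loglik_maximizer_unique:
  fixes x :: "'j::finite \<Rightarrow> nat \<Rightarrow> real ^ 'p::finite"
  assumes rank: "full_column_rank K x"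
    and F: "F = (\<lambda>(\<beta>, b). avg_loglik K x y \<beta> b)"
    and max: "\<And>v. F v \<le> F a"
    and eq: "F v = F a"
  shows "v = a"
proof (rule ccontr)
  assume "v \<noteq> a"
  define m where "m = (1 / 2) *\<^sub>R (v + a)"
  define h where "h j k v = real (y j k) * linear_predictor x j k v - ln (1 + exp (linear_predictor x j k v))"
    for j k and v :: "(real ^ 'p) \<times> (real ^ 'j)"
  have Fh: "F v = 1 / real (num_obs K) * (\<Sum>j\<in>UNIV. \<Sum>k=1..K j. h j k v)" for v
    by (simp add: F h_def avg_loglik_eq_linear_predictor)
  have lm: "linear_predictor x j k m = (linear_predictor x j k v + linear_predictor x j k a) / 2" for j k
    by (simp add: m_def linear_predictor_def inner_add_right field_simps)
  have less: "h j k v + h j k a < 2 * h j k m"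
    if "linear_predictor x j k v \<noteq> linear_predictor x j k a" for j k
    using softplus_midpoint_less[OF that] by (simp add: h_def lm algebra_simps add_divide_distrib)
  then have le: "h j k v + h j k a \<le> 2 * h j k m" for j k
    by (cases "linear_predictor x j k v = linear_predictor x j k a")
      (auto simp: h_def lm intro: less_imp_le)
  have "v - a \<noteq> 0"
    using \<open>v \<noteq> a\<close> by simp
  then obtain j k where k: "k \<in> {1..K j}" and "linear_predictor x j k (v - a) \<noteq> 0"
    using full_column_rank_linear_predictor[OF rank] by blast
  then have ne: "linear_predictor x j k v \<noteq> linear_predictor x j k a"
    by (simp add: linear_diff[OF linear_linear_predictor])
  have "(\<Sum>k=1..K j. h j k v + h j k a) < (\<Sum>k=1..K j. 2 * h j k m)"
    using k less[OF ne] le by (intro sum_strict_mono_ex1) auto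
  then have "(\<Sum>j\<in>UNIV. \<Sum>k=1..K j. h j k v + h j k a) < (\<Sum>j\<in>UNIV. \<Sum>k=1..K j. 2 * h j k m)"
    using le by (intro sum_strict_mono_ex1) (auto intro: sum_mono)
  then have "(\<Sum>j\<in>UNIV. \<Sum>k=1..K j. h j k v) + (\<Sum>j\<in>UNIV. \<Sum>k=1..K j. h j k a)
      < 2 * (\<Sum>j\<in>UNIV. \<Sum>k=1..K j. h j k m)"
    by (simp add: sum.distrib sum_distrib_left)
  then have "1 / real (num_obs K) * ((\<Sum>j\<in>UNIV. \<Sum>k=1..K j. h j k v) + (\<Sum>j\<in>UNIV. \<Sum>k=1..K j. h j k a))
      < 1 / real (num_obs K) * (2 * (\<Sum>j\<in>UNIV. \<Sum>k=1..K j. h j k m))"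
    by (rule mult_strict_left_mono) (use num_obs_pos[OF rank] in simp)
  then have "F v + F a < 2 * F m"
    unfolding Fh by (simp only: distrib_left mult.left_commute[of _ 2])
  then show False
    using max[of m] eq by simp
qed

section \<open>Score equations\<close>

text \<open>
  The derivative of the log-likelihood in the direction of the effect of cluster \<open>j\<close> vanishes at a
  maximizer; the observations of all other clusters drop out.
\<close>

lemma MLE_score_equation:
  assumes N: "0 < num_obs K"
    and max: "\<And>b'. avg_loglik K x y \<beta> b' \<le> avg_loglik K x y \<beta> b"
  shows "(\<Sum>k=1..K j. exp (x j k \<bullet> \<beta> + b $ j) / (1 + exp (x j k \<bullet> \<beta> + b $ j)))
    = real (\<Sum>k=1..K j. y j k)"
proof -
  define e :: "real ^ 'a" where "e = axis j 1"
  define \<sigma> where "\<sigma> i k = exp (x i k \<bullet> \<beta> + b $ i) / (1 + exp (x i k \<bullet> \<beta> + b $ i))" for i k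
  have pos: "0 < 1 + exp z" for z :: real
    by (simp add: add_pos_pos)
  have summand: "((\<lambda>t. real (y i k) * (x i k \<bullet> \<beta> + (b $ i + t * e $ i))
        - ln (1 + exp (x i k \<bullet> \<beta> + (b $ i + t * e $ i))))
      has_real_derivative e $ i * (real (y i k) - \<sigma> i k)) (at 0)" for i k
    using pos by (auto intro!: derivative_eq_intros simp: \<sigma>_def algebra_simps)
  have "((\<lambda>t. avg_loglik K x y \<beta> (b + t *\<^sub>R e)) has_real_derivative
      1 / real (num_obs K) * (\<Sum>i\<in>UNIV. \<Sum>k=1..K i. e $ i * (real (y i k) - \<sigma> i k))) (at 0)"
    unfolding avg_loglik_def
    by (intro DERIV_cmult DERIV_sum) (use summand in simp)
  then have "1 / real (num_obs K) * (\<Sum>i\<in>UNIV. \<Sum>k=1..K i. e $ i * (real (y i k) - \<sigma> i k)) = 0"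
    by (rule DERIV_local_max[of _ _ _ 1]) (use max in auto)
  then have "0 = (\<Sum>i\<in>UNIV. \<Sum>k=1..K i. e $ i * (real (y i k) - \<sigma> i k))"
    using N by simp
  also have "\<dots> = (\<Sum>i\<in>UNIV. e $ i * (\<Sum>k=1..K i. real (y i k) - \<sigma> i k))"
    by (simp add: sum_distrib_left)
  also have "\<dots> = (\<Sum>k=1..K j. real (y j k) - \<sigma> j k)"
    by (simp add: e_def axis_def if_distrib[of "\<lambda>z. z * _"] sum.delta' cong: if_cong)
  finally show ?thesis
    by (simp add: \<sigma>_def sum_subtractf)
qed

lemma logistic_mono:
  fixes s t :: real
  assumes "s \<le> t"
  shows "exp s / (1 + exp s) \<le> exp t / (1 + exp t)"
proof -
  have "exp s * (1 + exp t) \<le> exp t * (1 + exp s)"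
    using assms by (simp add: algebra_simps)
  then show ?thesis
    by (simp add: divide_simps add_pos_pos)
qed

text \<open>
  The right-hand side is the value of the same sum at \<open>v\<close>. Shifting \<open>u\<close> by \<open>\<Sum>\<^sub>k \<bar>v k - u k\<bar>\<close> up or down moves \<open>u\<close> above or below \<open>v\<close> at every index,
  where monotonicity gives the inequalities required by the intermediate value theorem.
\<close>

lemma logistic_sum_shift_solvable:
  fixes u v :: "'k \<Rightarrow> real"
  assumes A: "finite A"
  obtains b where "(\<Sum>k\<in>A. exp (u k + b) / (1 + exp (u k + b))) = (\<Sum>k\<in>A. exp (v k) / (1 + exp (v k)))"
proof -
  define f where "f b = (\<Sum>k\<in>A. exp (u k + b) / (1 + exp (u k + b)))" for b
  define c where "c = (\<Sum>k\<in>A. \<bar>v k - u k\<bar>)"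
  have c: "\<bar>v k - u k\<bar> \<le> c" if "k \<in> A" for k
    unfolding c_def using A that by (intro member_le_sum) auto
  have "f (- c) \<le> (\<Sum>k\<in>A. exp (v k) / (1 + exp (v k)))"
    unfolding f_def using c by (intro sum_mono logistic_mono) (force simp: abs_le_iff)
  moreover have "(\<Sum>k\<in>A. exp (v k) / (1 + exp (v k))) \<le> f c"
    unfolding f_def using c by (intro sum_mono logistic_mono) (force simp: abs_le_iff)
  moreover have "- c \<le> c"
    by (simp add: c_def sum_nonneg)
  moreover have "1 + exp z \<noteq> 0" for z :: real
    using exp_gt_zero[of z] by linarith
  then have "continuous_on {- c..c} f"
    unfolding f_def by (auto intro!: continuous_intros)
  ultimately show ?thesis
    using IVT'[of f "- c" _ c] that unfolding f_def by blast
qed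

section \<open>Comparison of the two likelihoods\<close>

text \<open>
  The left-hand side is what the coefficient bounds produce in place of
  \<open>\<Sum>\<^sub>j ln g\<^sub>j\<close>, the logarithms of the conditional normalizers.
\<close>

lemma sum_tilted_logs_eq_avg_loglik:
  assumes N: "0 < num_obs K"
  shows "(\<Sum>j\<in>UNIV. real R * ((\<Sum>k=1..K j. ln (1 + exp (x j k \<bullet> \<beta> + b $ j)))
        - b $ j * real (\<Sum>k=1..K j. y j k)))
    = real R * (\<Sum>j\<in>UNIV. \<Sum>k=1..K j. real (y j k) * (x j k \<bullet> \<beta>))
      - real R * (real (num_obs K) * avg_loglik K x y \<beta> b)"
  using N by (simp add: avg_loglik_def sum_distrib_left sum_subtractf sum.distrib algebra_simps)

text \<open>
  The coefficient bound used here holds for every tilt, so the conditional log-likelihood dominates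
  the full one for all values of the cluster effects at once, hence also its profile over them.
\<close>

lemma avg_loglik_le_avg_cond_loglik:
  assumes R: "0 < R" and N: "0 < num_obs K"
    and pos: "\<And>j. 0 < cond_normalizer K x j R (\<Sum>k=1..K j. y j k) \<beta>"
  shows "avg_loglik K x y \<beta> b \<le> avg_cond_loglik K x y R \<beta>"
proof -
  let ?T = "\<lambda>j. \<Sum>k=1..K j. y j k"
  let ?g = "\<lambda>j. cond_normalizer K x j R (?T j) \<beta>"
  let ?s = "\<lambda>j. \<Sum>k=1..K j. ln (1 + exp (x j k \<bullet> \<beta> + b $ j))"
  have "ln (?g j) \<le> real R * (?s j - b $ j * real (?T j))" for j
  proof -
    have "exp (b $ j * real (R * ?T j)) * ?g j \<le> (\<Prod>k=1..K j. (1 + exp (x j k \<bullet> \<beta> + b $ j)) ^ R)"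
      unfolding cond_normalizer_eq_coeff by (rule coeff_binomial_gf_upper) simp
    then have "ln (exp (b $ j * real (R * ?T j)) * ?g j)
        \<le> ln (\<Prod>k=1..K j. (1 + exp (x j k \<bullet> \<beta> + b $ j)) ^ R)"
      using pos[of j] by (intro ln_mono) auto
    then have "b $ j * real (R * ?T j) + ln (?g j) \<le> real R * ?s j"
      using pos[of j] by (simp only: ln_mult_pos exp_gt_zero ln_exp ln_prod_logistic_power finite_atLeastAtMost)
    then show ?thesis
      by (simp add: algebra_simps)
  qed
  then have "(\<Sum>j\<in>UNIV. ln (?g j)) \<le> (\<Sum>j\<in>UNIV. real R * (?s j - b $ j * real (?T j)))"
    by (intro sum_mono)
  also have "\<dots> = real R * (\<Sum>j\<in>UNIV. \<Sum>k=1..K j. real (y j k) * (x j k \<bullet> \<beta>))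
      - real R * (real (num_obs K) * avg_loglik K x y \<beta> b)"
    by (rule sum_tilted_logs_eq_avg_loglik[OF N])
  finally show ?thesis
    using R N by (simp add: avg_cond_loglik_def field_simps)
qed

text \<open>
  The logarithms of the factors \<open>(n + 1)\<^sup>2\<close> lost when the sum of all coefficients is replaced by the
  one at the mean, where \<open>n = R * K j\<close> is the degree in cluster \<open>j\<close>, on the scale of the average
  log-likelihood.
\<close>

definition comparison_error :: "('j::finite \<Rightarrow> nat) \<Rightarrow> nat \<Rightarrow> real" where
  "comparison_error K R = (\<Sum>j\<in>UNIV. 2 * ln (real (R * K j) + 1) / real R) / real (num_obs K)"

lemma comparison_error_tendsto_zero: "comparison_error K \<longlonglongrightarrow> 0"
proof -
  have lim: "(\<lambda>R. 2 * ln (real (R * K j) + 1) / real R) \<longlonglongrightarrow> 0" for j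
  proof (cases "K j = 0")
    case False
    define c where "c = real (K j)"
    have "0 < c"
      using False by (simp add: c_def)
    then have "(\<lambda>R. 2 * ln (real R * c + 1) / real R) \<longlonglongrightarrow> 0"
      by real_asymp
    then show ?thesis
      by (simp add: c_def)
  qed simp
  have "(\<lambda>R. (\<Sum>j\<in>UNIV. 2 * ln (real (R * K j) + 1) / real R) / real (num_obs K))
      \<longlonglongrightarrow> (\<Sum>j\<in>(UNIV::'a set). 0) / real (num_obs K)"
    unfolding divide_inverse[of _ "real (num_obs K)"]
    by (intro tendsto_mult_right tendsto_sum lim)
  then show ?thesis
    by (simp add: comparison_error_def[abs_def])
qed

text \<open>
  If \<open>b\<close> solves the score equations of all clusters at \<open>\<beta>\<close>, every tilted coefficient sits at the
  mean. The error depends neither on \<open>\<beta>\<close> nor on \<open>b\<close>, which later allows evaluating the bound at the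
  moving point \<open>\<beta>\<^sub>c R\<close>.
\<close>

lemma avg_cond_loglik_le_avg_loglik:
  assumes R: "0 < R" and N: "0 < num_obs K"
    and score: "\<And>j. (\<Sum>k=1..K j. exp (x j k \<bullet> \<beta> + b $ j) / (1 + exp (x j k \<bullet> \<beta> + b $ j)))
      = real (\<Sum>k=1..K j. y j k)"
  shows "avg_cond_loglik K x y R \<beta> \<le> avg_loglik K x y \<beta> b + comparison_error K R"
    and "0 < cond_normalizer K x j R (\<Sum>k=1..K j. y j k) \<beta>"
proof -
  let ?T = "\<lambda>j. \<Sum>k=1..K j. y j k"
  let ?g = "\<lambda>j. cond_normalizer K x j R (?T j) \<beta>"
  let ?s = "\<lambda>j. \<Sum>k=1..K j. ln (1 + exp (x j k \<bullet> \<beta> + b $ j))"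
  have pos: "0 < ?g j" for j
    unfolding cond_normalizer_eq_coeff using score by (intro coeff_binomial_gf_lower(2)) auto
  then show "0 < cond_normalizer K x j R (\<Sum>k=1..K j. y j k) \<beta>" .
  have "real R * (?s j - b $ j * real (?T j)) - 2 * ln (real (R * K j) + 1) \<le> ln (?g j)" for j
  proof -
    have "(\<Prod>k=1..K j. (1 + exp (x j k \<bullet> \<beta> + b $ j)) ^ R)
        \<le> (real (R * card {1..K j}) + 1)\<^sup>2 * (exp (b $ j * real (R * ?T j)) * ?g j)"
      unfolding cond_normalizer_eq_coeff using score by (intro coeff_binomial_gf_lower(1)) auto
    then have "ln (\<Prod>k=1..K j. (1 + exp (x j k \<bullet> \<beta> + b $ j)) ^ R)
        \<le> ln ((real (R * K j) + 1)\<^sup>2 * (exp (b $ j * real (R * ?T j)) * ?g j))"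
      by (intro ln_mono) (auto intro!: prod_pos simp: add_pos_pos)
    also have "\<dots> = 2 * ln (real (R * K j) + 1) + (b $ j * real (R * ?T j) + ln (?g j))"
    proof -
      have "0 < real (R * K j) + 1"
        by (rule add_nonneg_pos) simp_all
      then show ?thesis
        using pos[of j]
        by (simp only: ln_mult_pos ln_realpow ln_exp of_nat_numeral zero_less_power exp_gt_zero mult_pos_pos)
    qed
    finally have "real R * ?s j \<le> 2 * ln (real (R * K j) + 1) + (b $ j * real (R * ?T j) + ln (?g j))"
      by (simp only: ln_prod_logistic_power finite_atLeastAtMost)
    then show ?thesis
      by (simp add: algebra_simps)
  qed
  then have "(\<Sum>j\<in>UNIV. real R * (?s j - b $ j * real (?T j)) - 2 * ln (real (R * K j) + 1))
      \<le> (\<Sum>j\<in>UNIV. ln (?g j))"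
    by (intro sum_mono)
  moreover have "(\<Sum>j\<in>UNIV. real R * (?s j - b $ j * real (?T j)) - 2 * ln (real (R * K j) + 1))
      = real R * (\<Sum>j\<in>UNIV. \<Sum>k=1..K j. real (y j k) * (x j k \<bullet> \<beta>))
      - real R * (real (num_obs K) * (avg_loglik K x y \<beta> b + comparison_error K R))"
  proof -
    have err: "(\<Sum>j\<in>UNIV. 2 * ln (real (R * K j) + 1)) = real R * (real (num_obs K) * comparison_error K R)"
      using N R by (simp add: comparison_error_def flip: sum_divide_distrib)
    show ?thesis
      by (simp only: sum_subtractf[of "\<lambda>j. real R * (?s j - _ j)"] sum_tilted_logs_eq_avg_loglik[OF N]
          err distrib_left diff_diff_eq)
  qed
  ultimately show "avg_cond_loglik K x y R \<beta> \<le> avg_loglik K x y \<beta> b + comparison_error K R"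
    using R N by (simp add: avg_cond_loglik_def field_simps)
qed

section \<open>Convergence of the conditional estimator\<close>

theorem theorem1:
  fixes M :: "'w measure"
    and K :: "'j::finite \<Rightarrow> nat"
    and Y :: "'j \<Rightarrow> nat \<Rightarrow> 'w \<Rightarrow> nat"
    and X :: "'j \<Rightarrow> nat \<Rightarrow> 'w \<Rightarrow> real ^ 'p::finite"
    and b :: "'j \<Rightarrow> 'w \<Rightarrow> real"
    and \<beta> :: "real ^ 'p"
    and \<omega> :: 'w
    and x :: "'j \<Rightarrow> nat \<Rightarrow> real ^ 'p"
    and y :: "'j \<Rightarrow> nat \<Rightarrow> nat"
    and \<beta>\<^sub>o :: "real ^ 'p"
    and \<beta>\<^sub>c :: "nat \<Rightarrow> real ^ 'p"
  assumes model: "cluster_logistic_model M K Y X b \<beta>"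
    and outcome: "\<omega> \<in> space M"
    and x_data: "x = (\<lambda>j k. X j k \<omega>)"
    and y_data: "y = (\<lambda>j k. Y j k \<omega>)"
    and column_rank: "full_column_rank K x"
    and MLE: "is_MLE K x y \<beta>\<^sub>o"
    and CMLE: "\<And>R. R > 0 \<Longrightarrow> is_CMLE K x y R (\<beta>\<^sub>c R)"
  shows "\<beta>\<^sub>c \<longlonglongrightarrow> \<beta>\<^sub>o"
proof -
  let ?L = "\<lambda>(\<beta>, b). avg_loglik K x y \<beta> b"
  have N: "0 < num_obs K"
    using column_rank by (rule num_obs_pos)
  obtain b\<^sub>o where max: "?L v \<le> ?L (\<beta>\<^sub>o, b\<^sub>o)" for v
    using MLE by (auto simp: is_MLE_def is_arg_max_linorder)
  (* The cluster effects that profile the likelihood at an arbitrary coefficient vector. *)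
  have "\<exists>c. \<forall>j. (\<Sum>k=1..K j. exp (x j k \<bullet> \<gamma> + c $ j) / (1 + exp (x j k \<bullet> \<gamma> + c $ j)))
      = real (\<Sum>k=1..K j. y j k)" for \<gamma>
  proof -
    have "\<exists>c. (\<Sum>k=1..K j. exp (x j k \<bullet> \<gamma> + c) / (1 + exp (x j k \<bullet> \<gamma> + c)))
        = real (\<Sum>k=1..K j. y j k)" for j
      using logistic_sum_shift_solvable[of "{1..K j}" "\<lambda>k. x j k \<bullet> \<gamma>" "\<lambda>k. x j k \<bullet> \<beta>\<^sub>o + b\<^sub>o $ j"]
        MLE_score_equation[OF N, of x y \<beta>\<^sub>o b\<^sub>o j] max[of "(\<beta>\<^sub>o, _)"] by auto
    then have "\<exists>c. \<forall>j. (\<Sum>k=1..K j. exp (x j k \<bullet> \<gamma> + c j) / (1 + exp (x j k \<bullet> \<gamma> + c j)))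
        = real (\<Sum>k=1..K j. y j k)"
      by (intro choice allI)
    then obtain c where "\<forall>j. (\<Sum>k=1..K j. exp (x j k \<bullet> \<gamma> + c j) / (1 + exp (x j k \<bullet> \<gamma> + c j)))
        = real (\<Sum>k=1..K j. y j k)" ..
    then show ?thesis
      by (intro exI[of _ "\<chi> j. c j"]) simp
  qed
  then have "\<exists>c. \<forall>\<gamma> j. (\<Sum>k=1..K j. exp (x j k \<bullet> \<gamma> + c \<gamma> $ j) / (1 + exp (x j k \<bullet> \<gamma> + c \<gamma> $ j)))
      = real (\<Sum>k=1..K j. y j k)"
    by (intro choice allI)
  then obtain c where score: "(\<Sum>k=1..K j. exp (x j k \<bullet> \<gamma> + c \<gamma> $ j) / (1 + exp (x j k \<bullet> \<gamma> + c \<gamma> $ j)))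
      = real (\<Sum>k=1..K j. y j k)" for \<gamma> j
    by blast
  define \<theta> where "\<theta> R = (\<beta>\<^sub>c R, c (\<beta>\<^sub>c R))" for R
  have lower: "?L (\<beta>\<^sub>o, b\<^sub>o) - comparison_error K R \<le> ?L (\<theta> R)" if R: "0 < R" for R
  proof -
    have "?L (\<beta>\<^sub>o, b\<^sub>o) \<le> avg_cond_loglik K x y R \<beta>\<^sub>o"
      using avg_loglik_le_avg_cond_loglik[OF R N avg_cond_loglik_le_avg_loglik(2)[OF R N score]] by simp
    also have "\<dots> \<le> avg_cond_loglik K x y R (\<beta>\<^sub>c R)"
      using CMLE[OF R] by (auto simp: is_CMLE_def is_arg_max_linorder)
    also have "\<dots> \<le> ?L (\<theta> R) + comparison_error K R"
      using avg_cond_loglik_le_avg_loglik(1)[OF R N score] by (simp add: \<theta>_def)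
    finally show ?thesis
      by simp
  qed
  have "(\<lambda>R. ?L (\<theta> R)) \<longlonglongrightarrow> ?L (\<beta>\<^sub>o, b\<^sub>o)"
  proof (rule tendsto_sandwich)
    show "\<forall>\<^sub>F R in sequentially. ?L (\<beta>\<^sub>o, b\<^sub>o) - comparison_error K R \<le> ?L (\<theta> R)"
      using eventually_gt_at_top[of 0] by eventually_elim (rule lower)
    show "\<forall>\<^sub>F R in sequentially. ?L (\<theta> R) \<le> ?L (\<beta>\<^sub>o, b\<^sub>o)"
      by (intro always_eventually allI max)
    show "(\<lambda>R. ?L (\<beta>\<^sub>o, b\<^sub>o) - comparison_error K R) \<longlonglongrightarrow> ?L (\<beta>\<^sub>o, b\<^sub>o)"
      using tendsto_diff[OF tendsto_const comparison_error_tendsto_zero] by simp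
  qed (rule tendsto_const)
  then have "\<theta> \<longlonglongrightarrow> (\<beta>\<^sub>o, b\<^sub>o)"
    using concave_on_avg_loglik max avg_loglik_maximizer_unique[OF column_rank refl max]
    by (intro concave_maximizing_sequence_tendsto[where f = ?L]) auto
  then have "(\<lambda>R. fst (\<theta> R)) \<longlonglongrightarrow> fst (\<beta>\<^sub>o, b\<^sub>o)"
    by (rule tendsto_fst)
  then show ?thesis
    by (simp add: \<theta>_def)
qed

end
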